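(* Let $K_{m,n}$ be the complete bipartite graph with bipartition $(X,Y)$, $|X|=m$, $|Y|=n$. Let $T$ be any tree which is a subgraph of $K_{m,n}$, and put $s=|V(T)\cap X|$, $t=|V(T)\cap Y|$. Then the number $\tau_T(K_{m,n})$ of spanning trees of $K_{m,n}$ containing all edges of $T$ is $$\tau_T(K_{m,n})=(sn+tm-st)\,m^{n-t-1}n^{m-s-1}.$$
   Context: For a subgraph $H$ of a graph $G$, $\tau_H(G)$ denotes the number of spanning trees of $G$ containing all edges of $H$. *)

theory Defs
  imports Complex_Main
begin

(* Undirected simple graphs. The trees of the AFP entry Graph_Theory are digraph notions for which
   u,v,u is already a cycle, so no symmetric digraph with an edge is a tree there. *)

datatype 'a ugraph = UGraph (verts: "'a set") (edges: "'a set set")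

definition simple_graph :: "'a ugraph \<Rightarrow> bool" where
  "simple_graph G \<longleftrightarrow> (\<forall>e\<in>edges G. e \<subseteq> verts G \<and> card e = 2)"

definition subgraph :: "'a ugraph \<Rightarrow> 'a ugraph \<Rightarrow> bool" where
  "subgraph H G \<longleftrightarrow> simple_graph H \<and> verts H \<subseteq> verts G \<and> edges H \<subseteq> edges G"

definition walk :: "'a ugraph \<Rightarrow> 'a list \<Rightarrow> bool" where
  "walk G p \<longleftrightarrow> p \<noteq> [] \<and> set p \<subseteq> verts G \<and> successively (\<lambda>u v. {u, v} \<in> edges G) p"

definition connected_graph :: "'a ugraph \<Rightarrow> bool" where
  "connected_graph G \<longleftrightarrow> verts G \<noteq> {} \<and>
     (\<forall>u\<in>verts G. \<forall>v\<in>verts G. \<exists>p. walk G p \<and> hd p = u \<and> last p = v)"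

(* A cycle is listed without repeating its first vertex at the end. *)
definition cycle :: "'a ugraph \<Rightarrow> 'a list \<Rightarrow> bool" where
  "cycle G p \<longleftrightarrow> walk G p \<and> distinct p \<and> 3 \<le> length p \<and> {last p, hd p} \<in> edges G"

definition tree :: "'a ugraph \<Rightarrow> bool" where
  "tree G \<longleftrightarrow> simple_graph G \<and> connected_graph G \<and> (\<nexists>p. cycle G p)"

definition spanning_tree :: "'a ugraph \<Rightarrow> 'a ugraph \<Rightarrow> bool" where
  "spanning_tree S G \<longleftrightarrow> subgraph S G \<and> verts S = verts G \<and> tree S"

definition tau :: "'a ugraph \<Rightarrow> 'a ugraph \<Rightarrow> nat" where
  "tau H G = card {S. spanning_tree S G \<and> edges H \<subseteq> edges S}"

definition complete_bipartite :: "'a set \<Rightarrow> 'a set \<Rightarrow> 'a ugraph" where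
  "complete_bipartite X Y = UGraph (X \<union> Y) {{x, y} | x y. x \<in> X \<and> y \<in> Y}"

end

theory Submission
  imports Defs "HOL-Library.FuncSet"
begin

text \<open>
  Orient every edge of a spanning tree outside \<open>T\<close> towards \<open>T\<close>: the spanning trees containing
  \<open>T\<close> correspond to the maps that send each vertex outside \<open>T\<close> to a neighbour, its parent, such
  that iteration always ends in \<open>T\<close>. For a complete bipartite graph with \<open>a\<close>, \<open>b\<close> vertices outside
  and \<open>s\<close>, \<open>t\<close> vertices inside \<open>T\<close>, let \<open>N(a, b, s, t)\<close> be the number of such maps. If \<open>i\<close> and \<open>j\<close>
  count the vertices whose parent lies in \<open>T\<close>, these are the roots for the remaining vertices, so
  \<open>N(a, b, s, t)\<close> is the sum over \<open>i\<close> and \<open>j\<close> of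
  \<open>(a choose i) (b choose j) t^i s^j N(a - i, b - j, i, j)\<close>. Induction and the binomial theorem give
  \<open>N(a, b, s, t) = (s b + t a + s t) (a + s)^(b - 1) (b + t)^(a - 1)\<close>.
\<close>

section \<open>Walks and cycles\<close>

text \<open>Reachability as a relation: connectedness then follows by linking every vertex to one
  root, without handling lists.\<close>

definition linked :: "'a ugraph \<Rightarrow> 'a \<Rightarrow> 'a \<Rightarrow> bool" where
  "linked G u v \<longleftrightarrow> (\<exists>p. walk G p \<and> hd p = u \<and> last p = v)"

lemma connected_graph_iff_linked:
  "connected_graph G \<longleftrightarrow> verts G \<noteq> {} \<and> (\<forall>u\<in>verts G. \<forall>v\<in>verts G. linked G u v)"
  by (simp add: connected_graph_def linked_def)

lemma walk_append:
  assumes "walk G p" "walk G q" "{last p, hd q} \<in> edges G"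
  shows "walk G (p @ q)"
  using assms by (auto simp: walk_def successively_append_iff)

lemma linked_edge:
  assumes "u \<in> verts G" "v \<in> verts G" "{u, v} \<in> edges G"
  shows "linked G u v"
  unfolding linked_def using assms by (intro exI[of _ "[u, v]"]) (simp add: walk_def)

lemma linked_sym:
  assumes "linked G u v"
  shows "linked G v u"
proof -
  obtain p where p: "walk G p" "hd p = u" "last p = v"
    using assms by (auto simp: linked_def)
  have "walk G (rev p)"
    using p(1) by (simp add: walk_def insert_commute)
  moreover have "hd (rev p) = v" "last (rev p) = u"
    using p by (auto simp: walk_def hd_rev last_rev)
  ultimately show ?thesis
    by (auto simp: linked_def)
qed

lemma linked_trans:
  assumes "linked G u v" "linked G v w"
  shows "linked G u w"
proof -
  obtain p q where p: "walk G p" "hd p = u" "last p = v"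
    and q: "walk G q" "hd q = v" "last q = w"
    using assms by (auto simp: linked_def)
  \<comment> \<open>The two walks share \<open>v\<close>, so the second one loses its head before
    they are joined.\<close>
  obtain q' where q': "q = v # q'"
    using q by (cases q) (auto simp: walk_def)
  show ?thesis
  proof (cases "q' = []")
    case True
    then show ?thesis
      using p q q' by (auto simp: linked_def)
  next
    case False
    then have "walk G (p @ q')"
      using p q q' by (auto simp: walk_def successively_append_iff successively_Cons)
    moreover have "hd (p @ q') = u" "last (p @ q') = w"
      using p q q' False by (auto simp: walk_def)
    ultimately show ?thesis
      by (auto simp: linked_def)
  qed
qed

lemma linked_mono:
  assumes "linked H u v" "verts H \<subseteq> verts G" "edges H \<subseteq> edges G"
  shows "linked G u v"
proof -
  have "walk G p" if "walk H p" for p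
    using that assms(2,3) by (auto simp: walk_def elim!: successively_mono)
  then show ?thesis
    using assms(1) by (auto simp: linked_def)
qed

text \<open>Induction on the end of the walk: a path to the predecessor of \<open>w\<close> is
  extended by \<open>w\<close>, or cut off at \<open>w\<close> if it already passes through
  \<open>w\<close>.\<close>

lemma walk_imp_path:
  assumes "walk G p"
  shows "\<exists>q. walk G q \<and> distinct q \<and> hd q = hd p \<and> last q = last p"
  using assms
proof (induction p rule: rev_induct)
  case Nil
  then show ?case by (simp add: walk_def)
next
  case (snoc w p)
  show ?case
  proof (cases "p = []")
    case True
    then show ?thesis using snoc.prems by (intro exI[of _ "[w]"]) simp
  next
    case False
    have "walk G p" and w: "walk G [w]" and e: "{last p, w} \<in> edges G"
      using snoc.prems False by (auto simp: walk_def successively_append_iff)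
    then obtain q where q: "walk G q" "distinct q" "hd q = hd p" "last q = last p"
      using snoc.IH by blast
    show ?thesis
    proof (cases "w \<in> set q")
      case True
      then obtain q1 q2 where "q = q1 @ w # q2"
        by (meson split_list)
      then have "walk G (q1 @ [w]) \<and> distinct (q1 @ [w]) \<and> hd (q1 @ [w]) = hd p"
        using q by (cases q1)
          (auto simp: walk_def successively_append_iff successively_Cons hd_append split: if_splits)
      then show ?thesis
        using False by (intro exI[of _ "q1 @ [w]"]) simp
    next
      case notin: False
      have "walk G (q @ [w])"
        using walk_append[OF q(1) w] e q(4) by simp
      moreover have "hd (q @ [w]) = hd p"
        using q by (simp add: walk_def)
      ultimately show ?thesis
        using q notin False by (intro exI[of _ "q @ [w]"]) simp
    qed
  qed
qed

lemma cycle_two_neighbours: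
  assumes "cycle G p" "v \<in> set p"
  obtains u w where "u \<noteq> w" "u \<in> set p" "w \<in> set p" "{v, u} \<in> edges G" "{v, w} \<in> edges G"
proof -
  obtain p1 p2 where p: "p = p1 @ v # p2"
    using assms(2) by (meson split_list)
  \<comment> \<open>The rest of the cycle, read from the successor of \<open>v\<close> around to its
    predecessor. Both ends of \<open>r\<close> are adjacent to \<open>v\<close>, and they differ
    because \<open>r\<close> has at least two entries, all distinct.\<close>
  define r where "r = p2 @ p1"
  have len: "length r \<ge> 2" and dist: "distinct r" and sub: "set r \<subseteq> set p"
    using assms(1) by (auto simp: p r_def cycle_def)
  from len obtain a b r' where r: "r = a # b # r'"
    by (metis Suc_le_length_iff numeral_2_eq_2)
  have "hd r \<noteq> last r"
    using dist r by auto
  moreover have "hd r \<in> set p" "last r \<in> set p"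
    using sub r by auto
  moreover have "{v, hd r} \<in> edges G"
    using assms(1) len
    by (cases "p2 = []")
       (auto simp: p r_def cycle_def walk_def successively_append_iff successively_Cons
          hd_append split: if_splits)
  moreover have "{v, last r} \<in> edges G"
    using assms(1) len
    by (cases "p1 = []")
       (auto simp: p r_def cycle_def walk_def successively_append_iff successively_Cons
          insert_commute split: if_splits)
  ultimately show thesis
    using that by blast
qed

section \<open>Spanning trees as parent maps\<close>

text \<open>The height function \<open>h\<close> forces every iteration of \<open>f\<close> to leave \<open>D\<close>.\<close>

definition parent_maps :: "'a set \<Rightarrow> ('a \<Rightarrow> 'a set) \<Rightarrow> ('a \<Rightarrow> 'a) set" where
  "parent_maps D N = {f \<in> Pi\<^sub>E D N. \<exists>h :: 'a \<Rightarrow> nat. \<forall>v\<in>D. f v \<in> D \<longrightarrow> h (f v) < h v}"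

definition attach :: "'a ugraph \<Rightarrow> 'a set \<Rightarrow> ('a \<Rightarrow> 'a) \<Rightarrow> 'a ugraph" where
  "attach T D f = UGraph (verts T \<union> D) (edges T \<union> (\<lambda>v. {v, f v}) ` D)"

lemma verts_attach [simp]: "verts (attach T D f) = verts T \<union> D"
  and edges_attach [simp]: "edges (attach T D f) = edges T \<union> (\<lambda>v. {v, f v}) ` D"
  by (simp_all add: attach_def)

text \<open>By induction on the height, each vertex of \<open>D\<close> is linked through its parent
  to a fixed vertex \<open>r\<close> of \<open>T\<close>.\<close>

lemma connected_attach:
  fixes h :: "'a \<Rightarrow> nat"
  assumes conn: "connected_graph T"
    and f: "\<And>v. v \<in> D \<Longrightarrow> f v \<in> verts T \<union> D"
    and h: "\<And>v. v \<in> D \<Longrightarrow> f v \<in> D \<Longrightarrow> h (f v) < h v"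
  shows "connected_graph (attach T D f)"
proof -
  obtain r where r: "r \<in> verts T"
    using conn by (auto simp: connected_graph_def)
  have root: "linked (attach T D f) v r" if "v \<in> verts T" for v
    using conn that r linked_mono[of T v r "attach T D f"]
    by (auto simp: connected_graph_iff_linked)
  have D: "linked (attach T D f) v r" if "v \<in> D" for v
    using that
  proof (induction "h v" arbitrary: v rule: less_induct)
    case less
    have "linked (attach T D f) v (f v)"
      using less.prems f by (intro linked_edge) auto
    moreover have "linked (attach T D f) (f v) r"
      using less f[of v] h[of v] root by auto
    ultimately show ?case
      by (rule linked_trans)
  qed
  have "linked (attach T D f) v r" if "v \<in> verts (attach T D f)" for v
    using that root D by auto
  then show ?thesis
    unfolding connected_graph_iff_linked using r
    by (auto intro: linked_trans linked_sym)
qed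

text \<open>Every new edge has an endpoint in \<open>D\<close>, so a cycle that avoids
  \<open>D\<close> already lies in \<open>T\<close>. Any other cycle fails at a vertex of
  \<open>D\<close> of maximal height.\<close>

lemma acyclic_attach:
  fixes h :: "'a \<Rightarrow> nat"
  assumes T: "simple_graph T" "\<nexists>p. cycle T p" and disj: "verts T \<inter> D = {}"
    and h: "\<And>v. v \<in> D \<Longrightarrow> f v \<in> D \<Longrightarrow> h (f v) < h v"
  shows "\<not> cycle (attach T D f) p"
proof
  assume p: "cycle (attach T D f) p"
  have T_edge: "{u, v} \<in> edges T" if "{u, v} \<in> edges (attach T D f)" "u \<notin> D" "v \<notin> D" for u v
    using that by (auto simp: doubleton_eq_iff)
  show False
  proof (cases "set p \<inter> D = {}")
    case True
    have "successively (\<lambda>u v. {u, v} \<in> edges (attach T D f)) p"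
      using p by (simp add: cycle_def walk_def)
    then have "successively (\<lambda>u v. {u, v} \<in> edges T) p"
      by (rule successively_mono) (use True in \<open>blast intro: T_edge\<close>)
    moreover have "p \<noteq> []"
      using p by (auto simp: cycle_def)
    then have "{last p, hd p} \<in> edges T"
      using p True T_edge[of "last p" "hd p"] last_in_set[of p] hd_in_set[of p]
      unfolding cycle_def by blast
    ultimately have "cycle T p"
      using p True by (auto simp: cycle_def walk_def)
    then show False
      using T by blast
  next
    case False
    \<comment> \<open>A highest vertex of the cycle would have two parents.\<close>
    have "Max (h ` (set p \<inter> D)) \<in> h ` (set p \<inter> D)"
      using False by (intro Max_in) auto
    then obtain v where v: "v \<in> set p" "v \<in> D" and v_max: "Max (h ` (set p \<inter> D)) = h v"
      by blast
    have max: "h u \<le> h v" if "u \<in> set p" "u \<in> D" for u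
      using that by (auto simp: v_max[symmetric])
    \<comment> \<open>As \<open>v\<close> is outside \<open>T\<close>, the edge is the parent edge
      of \<open>v\<close> or of \<open>u\<close>; the latter would put \<open>u\<close> higher than
      \<open>v\<close>.\<close>
    have parent: "u = f v" if vu: "{v, u} \<in> edges (attach T D f)" "u \<in> set p" for u
    proof -
      have "{v, u} \<notin> edges T"
        using T(1) disj v(2) unfolding simple_graph_def by blast
      then obtain z where z: "z \<in> D" "{v, u} = {z, f z}"
        using vu by auto
      show ?thesis
      proof (cases "z = v")
        case True
        then show ?thesis using z by (auto simp: doubleton_eq_iff)
      next
        case False
        then have "z = u" "f u = v"
          using z by (auto simp: doubleton_eq_iff)
        then show ?thesis
          using h[of u] max[of u] vu z v by force
      qed
    qed
    obtain u w where "u \<noteq> w" "u \<in> set p" "w \<in> set p"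
      "{v, u} \<in> edges (attach T D f)" "{v, w} \<in> edges (attach T D f)"
      using cycle_two_neighbours[OF p v(1)] .
    then show False
      using parent by blast
  qed
qed

text \<open>Induction on the height for \<open>f\<close>. If \<open>f v\<close> and
  \<open>g v\<close> differ, then the edge from \<open>v\<close> to \<open>f v\<close> is a parent
  edge under \<open>g\<close> of the lower vertex \<open>f v\<close>. There \<open>f\<close> and
  \<open>g\<close> agree by induction, so \<open>v\<close> would be the parent of its own parent
  under \<open>f\<close>.\<close>

lemma inj_on_attach:
  assumes T: "simple_graph T" and disj: "verts T \<inter> D = {}"
  shows "inj_on (attach T D) (parent_maps D N)"
proof (rule inj_onI)
  fix f g
  assume f: "f \<in> parent_maps D N" and g: "g \<in> parent_maps D N"
    and eq: "attach T D f = attach T D g"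
  obtain h :: "'a \<Rightarrow> nat" where h: "\<And>v. v \<in> D \<Longrightarrow> f v \<in> D \<Longrightarrow> h (f v) < h v"
    using f by (auto simp: parent_maps_def)
  have "f v = g v" if "v \<in> D" for v
    using that
  proof (induction "h v" arbitrary: v rule: less_induct)
    case less
    have "{v, f v} \<in> edges (attach T D g)"
      using eq[symmetric] less.prems by simp
    moreover have "{v, f v} \<notin> edges T"
      using T disj less.prems unfolding simple_graph_def by blast
    ultimately obtain z where z: "z \<in> D" "{v, f v} = {z, g z}"
      by auto
    show ?case
    proof (cases "z = v")
      case True
      then show ?thesis using z by (auto simp: doubleton_eq_iff)
    next
      case False
      then have zf: "z = f v" "g z = v"
        using z by (auto simp: doubleton_eq_iff)
      then have lt: "h z < h v"
        using h z less.prems by auto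
      then have "f z = v"
        using less.hyps z zf by auto
      then have "h v < h z"
        using h[of z] z less.prems by auto
      then show ?thesis
        using lt by simp
    qed
  qed
  then show "f = g"
    using f g PiE_ext[of f D N g] by (auto simp: parent_maps_def)
qed

text \<open>An edge of \<open>S\<close> missing from \<open>H\<close> would close a path of
  \<open>H\<close> between its ends to a cycle of \<open>S\<close>.\<close>

lemma spanning_connected_subgraph_of_acyclic:
  assumes S: "simple_graph S" "\<nexists>p. cycle S p"
    and H: "connected_graph H" "verts H = verts S" "edges H \<subseteq> edges S"
  shows "edges H = edges S"
proof (rule ccontr)
  assume "edges H \<noteq> edges S"
  then obtain e where e: "e \<in> edges S" "e \<notin> edges H"
    using H by blast
  then obtain u v where uv: "e = {u, v}" "u \<noteq> v" "u \<in> verts S" "v \<in> verts S"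
    using S(1) by (auto simp: simple_graph_def card_2_iff)
  then obtain p0 where "walk H p0" "hd p0 = u" "last p0 = v"
    using H unfolding connected_graph_def by blast
  then obtain p where p: "walk H p" "distinct p" "hd p = u" "last p = v"
    using walk_imp_path by blast
  \<comment> \<open>A shorter path would force \<open>u = v\<close> or consist of the edge
    \<open>e\<close> itself, which is not in \<open>H\<close>.\<close>
  have "3 \<le> length p"
  proof (rule ccontr)
    assume "\<not> 3 \<le> length p"
    then consider "p = []" | a where "p = [a]" | a b where "p = [a, b]"
      by (cases p; cases "tl p"; cases "tl (tl p)") auto
    then show False
      using p uv e by cases (auto simp: walk_def)
  qed
  moreover have "walk S p"
    using p(1) H by (auto simp: walk_def elim!: successively_mono)
  ultimately have "cycle S p"
    using p uv e by (auto simp: cycle_def insert_commute)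
  then show False
    using S by blast
qed

text \<open>\<open>attach\<close> is a bijection from the parent maps onto the spanning trees that
  contain \<open>T\<close>.\<close>

lemma tau_eq_card_parent_maps:
  assumes G: "simple_graph G" and T: "tree T" "subgraph T G"
  shows "tau T G = card (parent_maps (verts G - verts T) (\<lambda>v. {w. {v, w} \<in> edges G}))"
proof -
  define D where "D = verts G - verts T"
  define N where "N = (\<lambda>v. {w. {v, w} \<in> edges G})"
  have T': "simple_graph T" "connected_graph T" "\<nexists>p. cycle T p"
    and sub: "verts T \<subseteq> verts G" "edges T \<subseteq> edges G"
    using T by (auto simp: tree_def subgraph_def)
  have disj: "verts T \<inter> D = {}" and VG: "verts T \<union> D = verts G"
    using sub by (auto simp: D_def)
  have N_verts: "w \<in> verts G" if "w \<in> N v" for v w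
    using that G by (auto simp: N_def simple_graph_def)
  have into: "spanning_tree (attach T D f) G" if f: "f \<in> parent_maps D N" for f
  proof -
    obtain h :: "'a \<Rightarrow> nat" where h: "\<And>v. v \<in> D \<Longrightarrow> f v \<in> D \<Longrightarrow> h (f v) < h v"
      using f by (auto simp: parent_maps_def)
    have fN: "f v \<in> N v" if "v \<in> D" for v
      using f that by (auto simp: parent_maps_def)
    have E: "edges (attach T D f) \<subseteq> edges G"
      using sub fN by (auto simp: N_def)
    then have "simple_graph (attach T D f)"
      using G VG by (auto simp: simple_graph_def simp del: edges_attach)
    moreover have "connected_graph (attach T D f)"
      using T'(2) h fN N_verts VG by (intro connected_attach[where h = h]) auto
    moreover have "\<nexists>p. cycle (attach T D f) p"
      using acyclic_attach[OF T'(1,3) disj, of f h] h by blast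
    ultimately show ?thesis
      using E VG by (simp add: spanning_tree_def tree_def subgraph_def del: edges_attach)
  qed
  have onto: "S \<in> attach T D ` parent_maps D N"
    if S: "spanning_tree S G" and TS: "edges T \<subseteq> edges S" for S
  proof -
    have S': "simple_graph S" "connected_graph S" "\<nexists>p. cycle S p" "verts S = verts G"
      "edges S \<subseteq> edges G"
      using S by (auto simp: spanning_tree_def tree_def subgraph_def)
    obtain r where r: "r \<in> verts T"
      using T' by (auto simp: connected_graph_def)
    \<comment> \<open>\<open>k\<close> counts vertices, so \<open>h v\<close> is one more than the
      distance from \<open>v\<close> to \<open>T\<close> in \<open>S\<close>. The parent of
      \<open>v\<close> will be the second vertex of a shortest walk to \<open>T\<close>.\<close>
    define escape where
      "escape v k \<longleftrightarrow> (\<exists>p. walk S p \<and> hd p = v \<and> last p \<in> verts T \<and> length p = k)" for v k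
    define h where "h v = (LEAST k. escape v k)" for v
    have "\<exists>w. {v, w} \<in> edges S \<and> h w < h v" if v: "v \<in> D" for v
    proof -
      have "\<exists>k. escape v k"
        using S' r sub v unfolding connected_graph_def escape_def D_def
        by (metis Diff_iff subsetD)
      then have "escape v (h v)"
        unfolding h_def by (rule LeastI_ex)
      then obtain p where p: "walk S p" "hd p = v" "last p \<in> verts T" "length p = h v"
        by (auto simp: escape_def)
      obtain q where q: "p = v # q"
        using p by (cases p) (auto simp: walk_def)
      have "q \<noteq> []"
        using p q v by (auto simp: D_def)
      then have "{v, hd q} \<in> edges S" "escape (hd q) (length q)"
        using p q unfolding escape_def
        by (auto simp: walk_def successively_Cons)
      moreover have "h (hd q) \<le> length q"
        unfolding h_def using calculation by (intro Least_le)
      ultimately show ?thesis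
        using p q by (intro exI[of _ "hd q"]) auto
    qed
    then obtain g where g: "\<And>v. v \<in> D \<Longrightarrow> {v, g v} \<in> edges S \<and> h (g v) < h v"
      by metis
    \<comment> \<open>Membership in \<open>Pi\<^sub>E\<close> requires the value
      \<open>undefined\<close> outside \<open>D\<close>.\<close>
    define f where "f = restrict g D"
    have f: "{v, f v} \<in> edges S" "h (f v) < h v" if "v \<in> D" for v
      using g that by (auto simp: f_def)
    have fN: "f v \<in> N v" if "v \<in> D" for v
      using f that S' by (auto simp: N_def)
    have f_mem: "f \<in> parent_maps D N"
      using fN f(2) by (auto simp: parent_maps_def f_def intro!: exI[of _ h])
    \<comment> \<open>The attached graph is a connected spanning subgraph of the tree
      \<open>S\<close>, hence all of \<open>S\<close>.\<close>
    have "connected_graph (attach T D f)"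
      using T'(2) f(2) N_verts[OF fN] VG by (intro connected_attach[where h = h]) auto
    then have "edges (attach T D f) = edges S"
      using f TS VG S' by (intro spanning_connected_subgraph_of_acyclic) auto
    then have "S = attach T D f"
      using VG S' by (intro ugraph.expand) simp
    then show ?thesis
      using f_mem by blast
  qed
  have "attach T D ` parent_maps D N = {S. spanning_tree S G \<and> edges T \<subseteq> edges S}"
    using into onto by auto
  then have "tau T G = card (attach T D ` parent_maps D N)"
    by (simp add: tau_def)
  also have "\<dots> = card (parent_maps D N)"
    by (intro card_image inj_on_attach T' disj)
  finally show ?thesis
    by (simp add: D_def N_def)
qed

section \<open>Counting bipartite parent maps\<close>

text \<open>\<open>A\<close> and \<open>S\<close> lie on one side, \<open>B\<close> and
  \<open>T\<close> on the other; \<open>S\<close> and \<open>T\<close> are the sets of roots. Here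
  \<open>T\<close> is a vertex set, not the tree.\<close>

abbreviation bipartite_parent_maps :: "'a set \<Rightarrow> 'a set \<Rightarrow> 'a set \<Rightarrow> 'a set \<Rightarrow> ('a \<Rightarrow> 'a) set" where
  "bipartite_parent_maps A B S T \<equiv>
     parent_maps (A \<union> B) (\<lambda>v. if v \<in> A then B \<union> T else A \<union> S)"

lemma finite_bipartite_parent_maps:
  assumes "finite A" "finite B" "finite S" "finite T"
  shows "finite (bipartite_parent_maps A B S T)"
  by (rule finite_subset[of _ "Pi\<^sub>E (A \<union> B) (\<lambda>v. if v \<in> A then B \<union> T else A \<union> S)"])
     (use assms in \<open>auto simp: parent_maps_def intro!: finite_PiE\<close>)

text \<open>Iteration would stay in \<open>D\<close> forever while the heights decrease. This
  disposes of an empty first layer in the recursion.\<close>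

lemma parent_maps_without_roots:
  assumes "D \<noteq> {}" "\<And>v. v \<in> D \<Longrightarrow> N v \<subseteq> D"
  shows "parent_maps D N = {}"
proof (rule equals0I)
  fix f assume "f \<in> parent_maps D N"
  then obtain h :: "'a \<Rightarrow> nat" where PiE: "f \<in> Pi\<^sub>E D N"
    and h: "\<And>v. v \<in> D \<Longrightarrow> f v \<in> D \<Longrightarrow> h (f v) < h v"
    by (auto simp: parent_maps_def)
  have f: "f v \<in> D" if "v \<in> D" for v
    using PiE_mem[OF PiE that] assms(2)[OF that] by blast
  obtain v where v: "v \<in> D"
    using assms(1) by blast
  show False
    using v by (induction "h v" arbitrary: v rule: less_induct) (use f h in blast)
qed

text \<open>The height condition is vacuous. This gives the base cases, where one side has no vertex
  outside the roots.\<close>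

lemma parent_maps_onto_roots:
  assumes "\<And>v. v \<in> D \<Longrightarrow> N v \<inter> D = {}"
  shows "parent_maps D N = Pi\<^sub>E D N"
proof -
  have "f v \<notin> D" if "f \<in> Pi\<^sub>E D N" "v \<in> D" for f v
    using that assms[of v] by (auto simp: PiE_iff)
  then show ?thesis
    by (auto simp: parent_maps_def)
qed

text \<open>The first layer \<open>I\<close>, \<open>J\<close> chooses its parents freely among the
  roots. The rest of the map never meets the old roots and is a parent map in which \<open>I\<close>
  and \<open>J\<close> serve as roots.\<close>

lemma card_bipartite_parent_maps_layer:
  assumes fin: "finite A" "finite B" "finite S" "finite T"
    and disj: "A \<inter> B = {}" "(A \<union> B) \<inter> (S \<union> T) = {}"
    and I: "I \<subseteq> A" and J: "J \<subseteq> B"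
  shows "card {f \<in> bipartite_parent_maps A B S T. {v\<in>A. f v \<in> T} = I \<and> {v\<in>B. f v \<in> S} = J} =
    card T ^ card I * card S ^ card J * card (bipartite_parent_maps (A - I) (B - J) I J)"
    (is "card ?F = _")
proof -
  let ?P = "bipartite_parent_maps (A - I) (B - J) I J"
  let ?R = "(I \<rightarrow>\<^sub>E T) \<times> (J \<rightarrow>\<^sub>E S) \<times> ?P"
  let ?D = "(A - I) \<union> (B - J)"
  define split where "split f = (restrict f I, restrict f J, restrict f ?D)" for f :: "'a \<Rightarrow> 'a"
  define join where
    "join = (\<lambda>(g1, g2, k) v. if v \<in> I then g1 v else if v \<in> J then g2 v else k v :: 'a)"
  have "bij_betw split ?F ?R"
  proof (rule bij_betw_byWitness[where f' = join])
    show "\<forall>f\<in>?F. join (split f) = f"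
    proof
      fix f assume f: "f \<in> ?F"
      then have "f v = undefined" if "v \<notin> A \<union> B" for v
        using that by (auto simp: parent_maps_def PiE_def extensional_def)
      then show "join (split f) = f"
        using I J by (auto simp: join_def split_def restrict_def fun_eq_iff)
    qed
    show "\<forall>x\<in>?R. split (join x) = x"
    proof
      fix x assume "x \<in> ?R"
      then obtain g1 g2 k where x: "x = (g1, g2, k)" "g1 \<in> I \<rightarrow>\<^sub>E T" "g2 \<in> J \<rightarrow>\<^sub>E S" "k \<in> ?P"
        by auto
      have "restrict (join x) I = g1"
        using x(2) by (auto simp: x(1) join_def restrict_def fun_eq_iff PiE_def extensional_def)
      moreover have "restrict (join x) J = g2"
        using x(3) I J disj
        by (auto simp: x(1) join_def restrict_def fun_eq_iff PiE_def extensional_def)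
      moreover have "restrict (join x) ?D = k"
        using x(4) I J disj
        by (auto simp: x(1) join_def restrict_def fun_eq_iff PiE_def extensional_def parent_maps_def)
      ultimately show "split (join x) = x"
        by (simp add: split_def x(1))
    qed
    show "split ` ?F \<subseteq> ?R"
    proof (rule image_subsetI)
      fix f assume f: "f \<in> ?F"
      then obtain h :: "'a \<Rightarrow> nat" where h: "\<And>v. v \<in> A \<union> B \<Longrightarrow> f v \<in> A \<union> B \<Longrightarrow> h (f v) < h v"
        by (auto simp: parent_maps_def)
      have f_PiE: "f \<in> Pi\<^sub>E (A \<union> B) (\<lambda>v. if v \<in> A then B \<union> T else A \<union> S)"
        using f by (simp add: parent_maps_def)
      have fA: "f v \<in> B \<union> T" if "v \<in> A" for v
        using PiE_mem[OF f_PiE, of v] that by simp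
      have fB: "f v \<in> A \<union> S" if "v \<in> B" for v
        using PiE_mem[OF f_PiE, of v] that disj by (auto split: if_splits)
      have IJ: "I = {v\<in>A. f v \<in> T}" "J = {v\<in>B. f v \<in> S}"
        using f by auto
      have "f v \<in> B - J \<union> J" if "v \<in> A" "v \<notin> I" for v
        using fA[of v] that IJ(1) by blast
      moreover have "f v \<in> A - I \<union> I" if "v \<in> B" "v \<notin> J" for v
        using fB[of v] that IJ(2) by blast
      ultimately have f_rest:
        "f v \<in> (if v \<in> A - I then B - J \<union> J else A - I \<union> I)" if "v \<in> ?D" for v
        using that by auto
      have "restrict f ?D \<in> ?P"
        unfolding parent_maps_def mem_Collect_eq
      proof (intro conjI exI[of _ h])
        show "restrict f ?D \<in> Pi\<^sub>E ?D (\<lambda>v. if v \<in> A - I then B - J \<union> J else A - I \<union> I)"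
          using f_rest unfolding restrict_PiE_iff by blast
        show "\<forall>v\<in>?D. restrict f ?D v \<in> ?D \<longrightarrow> h (restrict f ?D v) < h v"
          using h by auto
      qed
      moreover have "restrict f I \<in> I \<rightarrow>\<^sub>E T" "restrict f J \<in> J \<rightarrow>\<^sub>E S"
        using IJ by auto
      ultimately show "split f \<in> ?R"
        by (simp add: split_def)
    qed
    show "join ` ?R \<subseteq> ?F"
    proof (rule image_subsetI)
      fix x assume "x \<in> ?R"
      then obtain g1 g2 k where x: "x = (g1, g2, k)" "g1 \<in> I \<rightarrow>\<^sub>E T" "g2 \<in> J \<rightarrow>\<^sub>E S" "k \<in> ?P"
        by auto
      obtain h :: "'a \<Rightarrow> nat" where h: "\<And>v. v \<in> ?D \<Longrightarrow> k v \<in> ?D \<Longrightarrow> h (k v) < h v"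
        using x(4) by (auto simp: parent_maps_def)
      have jI: "join x v = g1 v" "g1 v \<in> T" if "v \<in> I" for v
        using that x(2) by (auto simp: x(1) join_def)
      have jJ: "join x v = g2 v" "g2 v \<in> S" if "v \<in> J" for v
        using that x(3) I J disj by (auto simp: x(1) join_def)
      have jk: "join x v = k v" if "v \<notin> I" "v \<notin> J" for v
        using that by (auto simp: x(1) join_def)
      have k_PiE: "k \<in> Pi\<^sub>E ?D (\<lambda>v. if v \<in> A - I then B - J \<union> J else A - I \<union> I)"
        using x(4) by (simp add: parent_maps_def)
      have kA: "k v \<in> B" if "v \<in> A" "v \<notin> I" for v
        using PiE_mem[OF k_PiE, of v] that J by auto
      have kB: "k v \<in> A" if "v \<in> B" "v \<notin> J" for v
        using PiE_mem[OF k_PiE, of v] that I disj by (auto split: if_splits)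
      have jA: "join x v \<in> B" if "v \<in> A" "v \<notin> I" for v
        using that kA jk J disj by (metis disjoint_iff subsetD)
      have jB: "join x v \<in> A" if "v \<in> B" "v \<notin> J" for v
        using that kB jk I disj by (metis disjoint_iff subsetD)
      have "join x v = undefined" if "v \<notin> A \<union> B" for v
        using that x(4) jk[of v] I J
        by (auto simp: parent_maps_def PiE_def extensional_def)
      then have PiE: "join x \<in> Pi\<^sub>E (A \<union> B) (\<lambda>v. if v \<in> A then B \<union> T else A \<union> S)"
        using jI jJ jA jB by (fastforce simp: PiE_iff extensional_def)
      \<comment> \<open>The first layer gets height 0 and all other heights rise by one, so a step
        into \<open>I\<close> or \<open>J\<close> also descends.\<close>
      define h' where "h' v = (if v \<in> I \<union> J then 0 else Suc (h v))" for v
      have "h' (join x v) < h' v" if "v \<in> A \<union> B" "join x v \<in> A \<union> B" for v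
      proof -
        have "v \<notin> I" "v \<notin> J"
          using that(2) jI[of v] jJ[of v] disj by auto
        then show ?thesis
          using that h[of v] jk[of v] by (auto simp: h'_def)
      qed
      then have "join x \<in> bipartite_parent_maps A B S T"
        unfolding parent_maps_def using PiE by blast
      moreover have "{v\<in>A. join x v \<in> T} = I" "{v\<in>B. join x v \<in> S} = J"
        using I J jI jJ jA jB disj by fastforce+
      ultimately show "join x \<in> ?F"
        by simp
    qed
  qed
  then have "card ?F = card ?R"
    by (rule bij_betw_same_card)
  also have "\<dots> = card T ^ card I * card S ^ card J * card ?P"
    using fin I J finite_subset[of I A] finite_subset[of J B]
    by (simp add: card_cartesian_product card_funcsetE)
  finally show ?thesis .
qed

lemma card_bipartite_parent_maps_rec:
  assumes fin: "finite A" "finite B" "finite S" "finite T"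
    and disj: "A \<inter> B = {}" "(A \<union> B) \<inter> (S \<union> T) = {}"
  shows "card (bipartite_parent_maps A B S T) = (\<Sum>I\<in>Pow A. \<Sum>J\<in>Pow B.
    card T ^ card I * card S ^ card J * card (bipartite_parent_maps (A - I) (B - J) I J))"
proof -
  let ?P = "bipartite_parent_maps A B S T"
  let ?layer = "\<lambda>f. ({v\<in>A. f v \<in> T}, {v\<in>B. f v \<in> S})"
  have "?layer ` ?P \<subseteq> Pow A \<times> Pow B"
    by blast
  then have "card ?P = (\<Sum>x\<in>Pow A \<times> Pow B. card {f \<in> ?P. ?layer f = x})"
    using sum.group[of ?P "Pow A \<times> Pow B" ?layer "\<lambda>_. 1 :: nat"]
      finite_bipartite_parent_maps[OF fin] fin by simp
  also have "\<dots> = (\<Sum>I\<in>Pow A. \<Sum>J\<in>Pow B. card {f \<in> ?P. {v\<in>A. f v \<in> T} = I \<and> {v\<in>B. f v \<in> S} = J})"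
    unfolding sum.cartesian_product by (intro sum.cong refl) auto
  also have "\<dots> = (\<Sum>I\<in>Pow A. \<Sum>J\<in>Pow B.
      card T ^ card I * card S ^ card J * card (bipartite_parent_maps (A - I) (B - J) I J))"
    using card_bipartite_parent_maps_layer[OF fin disj] by (intro sum.cong) auto
  finally show ?thesis .
qed

section \<open>Binomial sums for the recursion\<close>

lemma sum_Pow_card:
  fixes g :: "nat \<Rightarrow> real"
  assumes "finite A"
  shows "(\<Sum>I\<in>Pow A. g (card I)) = (\<Sum>i\<le>card A. real (card A choose i) * g i)"
proof -
  have "(\<Sum>I\<in>Pow A. g (card I)) = (\<Sum>i\<le>card A. \<Sum>I | I \<in> Pow A \<and> card I = i. g (card I))"
    using assms by (intro sum.group[symmetric]) (auto intro: card_mono)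
  also have "\<dots> = (\<Sum>i\<le>card A. real (card A choose i) * g i)"
    using n_subsets[OF assms] by (intro sum.cong) auto
  finally show ?thesis .
qed

text \<open>The term for \<open>i = 0\<close> vanishes; for the others the absorption identity
  \<open>Suc_times_binomial\<close> pulls out \<open>n\<close> and leaves a binomial expansion of
  exponent \<open>n - 1\<close>.\<close>

lemma sum_index_times_binomial:
  fixes x y :: real
  shows "(\<Sum>i\<le>n. real (n choose i) * (real i * x ^ i * y ^ (n - i))) = real n * x * (x + y) ^ (n - 1)"
proof (cases n)
  case (Suc k)
  have "(\<Sum>i\<le>n. real (n choose i) * (real i * x ^ i * y ^ (n - i))) =
      (\<Sum>i\<le>k. real (Suc i * (Suc k choose Suc i)) * (x ^ Suc i * y ^ (k - i)))"
    unfolding Suc by (subst sum.atMost_Suc_shift) (simp add: algebra_simps del: binomial_Suc_Suc)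
  also have "\<dots> = real n * x * (\<Sum>i\<le>k. real (k choose i) * x ^ i * y ^ (k - i))"
    unfolding Suc_times_binomial Suc sum_distrib_left 
    by (intro sum.cong) (simp_all only: of_nat_mult power_Suc mult_ac)
  finally show ?thesis
    by (simp add: Suc binomial_ring)
qed simp

text \<open>The summand is the recursion with the closed formula inserted for the remaining
  \<open>a - i\<close> and \<open>b - j\<close> vertices. Its bracket splits into two terms, each
  separating the variables \<open>i\<close> and \<open>j\<close>, so that only products of single
  sums remain.\<close>

lemma double_binomial_sum:
  fixes s t :: real
  assumes "a \<ge> 1" "b \<ge> 1"
  shows "(\<Sum>i\<le>a. real (a choose i) * (\<Sum>j\<le>b. real (b choose j) * (t ^ i * s ^ j *
      ((real i * real b + real j * (real a - real i)) * real a ^ (b - j) * real b ^ (a - i)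
        / (real a * real b))))) =
    (s * b + t * a + s * t) * (real a + s) ^ (b - 1) * (real b + t) ^ (a - 1)"
proof -
  define p where "p i = real (a choose i) * (t ^ i * real b ^ (a - i))" for i
  define q where "q j = real (b choose j) * (s ^ j * real a ^ (b - j))" for j
  have p0: "(\<Sum>i\<le>a. p i) = (real b + t) * (real b + t) ^ (a - 1)"
    using assms binomial_ring[of t "real b" a]
    by (simp add: p_def mult.assoc add.commute flip: power_Suc)
  have q0: "(\<Sum>j\<le>b. q j) = (real a + s) * (real a + s) ^ (b - 1)"
    using assms binomial_ring[of s "real a" b]
    by (simp add: q_def mult.assoc add.commute flip: power_Suc)
  have p1: "(\<Sum>i\<le>a. real i * p i) = a * t * (real b + t) ^ (a - 1)"
    using sum_index_times_binomial[of a t "real b"] by (simp add: p_def mult_ac add.commute)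
  have q1: "(\<Sum>j\<le>b. real j * q j) = b * s * (real a + s) ^ (b - 1)"
    using sum_index_times_binomial[of b s "real a"] by (simp add: q_def mult_ac add.commute)
  \<comment> \<open>The difference of \<open>a\<close> times \<open>p0\<close> and \<open>p1\<close>
    has the factor \<open>(b + t) - t = b\<close>.\<close>
  have p2: "(\<Sum>i\<le>a. (real a - real i) * p i) = a * b * (real b + t) ^ (a - 1)"
    using p0 p1 by (simp add: left_diff_distrib sum_subtractf algebra_simps flip: sum_distrib_left)
  have "(\<Sum>i\<le>a. real (a choose i) * (\<Sum>j\<le>b. real (b choose j) * (t ^ i * s ^ j *
      ((real i * real b + real j * (real a - real i)) * real a ^ (b - j) * real b ^ (a - i)
        / (real a * real b))))) =
    (\<Sum>i\<le>a. \<Sum>j\<le>b. (b * ((real i * p i) * q j) + ((real a - real i) * p i) * (real j * q j))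
        / (real a * real b))"
    unfolding sum_distrib_left
    by (intro sum.cong refl) (simp add: p_def q_def algebra_simps add_divide_distrib diff_divide_distrib)
  also have "\<dots> = (b * ((\<Sum>i\<le>a. real i * p i) * (\<Sum>j\<le>b. q j)) +
      (\<Sum>i\<le>a. (real a - real i) * p i) * (\<Sum>j\<le>b. real j * q j)) / (real a * real b)"
    unfolding sum_product
    by (simp only: sum.distrib sum_distrib_left sum_divide_distrib add_divide_distrib)
  also have "\<dots> = (s * b + t * a + s * t) * (real a + s) ^ (b - 1) * (real b + t) ^ (a - 1)"
    unfolding p1 p2 q0 q1 using assms by (simp add: field_simps)
  finally show ?thesis .
qed

text \<open>The shape with division covers \<open>a = 0\<close> and \<open>b = 0\<close>, where \<open>b - 1\<close> or \<open>a - 1\<close> would be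
  truncated.\<close>

lemma card_bipartite_parent_maps:
  assumes "finite A" "finite B" "finite S" "finite T"
    and "A \<inter> B = {}" "(A \<union> B) \<inter> (S \<union> T) = {}"
    and "A \<union> S \<noteq> {}" "B \<union> T \<noteq> {}"
    and "a = card A" "b = card B" "s = card S" "t = card T"
  shows "real (card (bipartite_parent_maps A B S T)) =
    (real s * real b + real t * real a + real s * real t) * real (a + s) ^ b * real (b + t) ^ a
      / (real (a + s) * real (b + t))"
  using assms
proof (induction "card A + card B" arbitrary: A B S T a b s t rule: less_induct)
  case less
  note fin = less.prems(1-4) and disj = less.prems(5,6) and card = less.prems(9-12)
  have pos: "a + s > 0" "b + t > 0"
    using fin less.prems(7,8) unfolding card by (auto simp: card_gt_0_iff)
  have cancel: "x * y * u * v / (x * y) = u * v" if "x \<noteq> 0" "y \<noteq> 0" for x y u v :: real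
    using that by simp
  \<comment> \<open>The linear factor differs from \<open>(a + s) * (b + t)\<close> only by the
    product \<open>a * b\<close>, which is zero here.\<close>
  have roots: "(real s * real b + real t * real a + real s * real t) * real (a + s) ^ b
      * real (b + t) ^ a / (real (a + s) * real (b + t)) = real (a + s) ^ b * real (b + t) ^ a"
    if "a = 0 \<or> b = 0"
  proof -
    have "real s * real b + real t * real a + real s * real t = real (a + s) * real (b + t)"
      using that by (auto simp: algebra_simps)
    then show ?thesis
      using pos by (simp only:) (rule cancel; simp only: of_nat_eq_0_iff; simp)
  qed
  consider "A = {}" | "B = {}" | "A \<noteq> {}" "B \<noteq> {}"
    by blast
  then show ?case
  proof cases
    case 1
    then have "bipartite_parent_maps A B S T = B \<rightarrow>\<^sub>E S"
      using disj by (subst parent_maps_onto_roots) auto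
    then show ?thesis
      using 1 fin by (subst roots) (simp_all add: card card_funcsetE)
  next
    case 2
    then have "bipartite_parent_maps A B S T =
        Pi\<^sub>E (A \<union> B) (\<lambda>v. if v \<in> A then B \<union> T else A \<union> S)"
      using disj by (intro parent_maps_onto_roots) auto
    also have "\<dots> = A \<rightarrow>\<^sub>E T"
      unfolding 2 Un_empty_right Un_empty_left by (rule PiE_cong) simp
    finally show ?thesis
      using 2 fin by (subst roots) (simp_all add: card card_funcsetE)
  next
    case 3
    then have ab: "a \<ge> 1" "b \<ge> 1"
      using fin by (simp_all add: card Suc_le_eq card_gt_0_iff)
    \<comment> \<open>The contribution of a first layer with \<open>i\<close> and \<open>j\<close>
      vertices. The bracket is \<open>i * (b - j) + j * (a - i) + i * j\<close> simplified; the
      bases are \<open>a\<close> and \<open>b\<close> because \<open>(a - i) + i = a\<close> and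
      \<open>(b - j) + j = b\<close>.\<close>
    define W where "W i j = real t ^ i * real s ^ j *
      ((real i * real b + real j * (real a - real i)) * real a ^ (b - j) * real b ^ (a - i)
        / (real a * real b))" for i j
    have step: "real (card T ^ card I * card S ^ card J *
        card (bipartite_parent_maps (A - I) (B - J) I J)) = W (card I) (card J)"
      if IJ: "I \<in> Pow A" "J \<in> Pow B" for I J
    proof (cases "I = {} \<and> J = {}")
      case True
      then show ?thesis
        using 3 by (subst parent_maps_without_roots) (auto simp: W_def)
    next
      case False
      have finIJ: "finite I" "finite J"
        using IJ fin by (auto intro: finite_subset)
      have le: "card I \<le> a" "card J \<le> b"
        using IJ fin by (auto simp: card intro: card_mono)
      have cIJ: "card (A - I) = a - card I" "card (B - J) = b - card J"
        using IJ finIJ by (auto simp: card card_Diff_subset)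
      have "card I > 0 \<or> card J > 0"
        using False finIJ by (auto simp: card_gt_0_iff)
      then have lt: "card (A - I) + card (B - J) < card A + card B"
        using cIJ le by (auto simp: card[symmetric])
      have fin': "finite (A - I)" "finite (B - J)"
        using fin by simp_all
      have disj': "(A - I) \<inter> (B - J) = {}" "((A - I) \<union> (B - J)) \<inter> (I \<union> J) = {}"
        and ne: "(A - I) \<union> I \<noteq> {}" "(B - J) \<union> J \<noteq> {}"
        using disj IJ 3 by auto
      have "real (card (bipartite_parent_maps (A - I) (B - J) I J)) =
          (real (card I) * real (b - card J) + real (card J) * real (a - card I)
            + real (card I) * real (card J))
          * real (a - card I + card I) ^ (b - card J) * real (b - card J + card J) ^ (a - card I)
          / (real (a - card I + card I) * real (b - card J + card J))"
        by (rule less.hyps[OF lt fin' finIJ disj' ne cIJ[symmetric] refl refl])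
      then show ?thesis
        using le by (simp add: W_def card[symmetric] of_nat_diff algebra_simps)
    qed
    have "real (card (bipartite_parent_maps A B S T)) = (\<Sum>I\<in>Pow A. \<Sum>J\<in>Pow B. W (card I) (card J))"
      unfolding card_bipartite_parent_maps_rec[OF fin disj] of_nat_sum
      by (intro sum.cong refl step)
    also have "\<dots> = (\<Sum>i\<le>a. real (a choose i) * (\<Sum>j\<le>b. real (b choose j) * W i j))"
      using sum_Pow_card[OF fin(1), of "\<lambda>i. \<Sum>j\<le>b. real (b choose j) * W i j"] fin
      by (simp add: sum_Pow_card card)
    also have "\<dots> = (real s * real b + real t * real a + real s * real t)
        * (real a + real s) ^ (b - 1) * (real b + real t) ^ (a - 1)"
      unfolding W_def by (rule double_binomial_sum[OF ab])
    finally show ?thesis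
      using ab pos by (cases a; cases b) (simp_all add: add.assoc)
  qed
qed

section \<open>Spanning trees of the complete bipartite graph\<close>

theorem theorem1p4:
  fixes X Y :: "'a set" and T :: "'a ugraph" and m n s t :: nat
  assumes "finite X" and "finite Y" and "X \<inter> Y = {}"
    and "card X = m" and "card Y = n" and "m \<ge> 1" and "n \<ge> 1"
    and "tree T" and "subgraph T (complete_bipartite X Y)"
    and "s = card (verts T \<inter> X)" and "t = card (verts T \<inter> Y)"
  shows "real (tau T (complete_bipartite X Y)) =
    (real s * real n + real t * real m - real s * real t)
      * real m powi (int n - int t - 1) * real n powi (int m - int s - 1)"
proof -
  define A where "A = X - verts T"
  define B where "B = Y - verts T"
  let ?G = "complete_bipartite X Y"
  have G: "verts ?G = X \<union> Y" "edges ?G = {{x, y} | x y. x \<in> X \<and> y \<in> Y}"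
    by (simp_all add: complete_bipartite_def)
  have "simple_graph ?G"
    using assms(3) by (auto simp: simple_graph_def G card_insert_if)
  then have "tau T ?G = card (parent_maps (verts ?G - verts T) (\<lambda>v. {w. {v, w} \<in> edges ?G}))"
    using assms by (intro tau_eq_card_parent_maps)
  \<comment> \<open>A vertex outside \<open>T\<close> is adjacent to the whole opposite side, which
    consists of its vertices outside \<open>T\<close> and the roots that \<open>T\<close> has
    there.\<close>
  also have "parent_maps (verts ?G - verts T) (\<lambda>v. {w. {v, w} \<in> edges ?G}) =
      bipartite_parent_maps A B (verts T \<inter> X) (verts T \<inter> Y)"
  proof -
    have D: "verts ?G - verts T = A \<union> B"
      by (auto simp: G A_def B_def)
    have N: "{w. {v, w} \<in> edges ?G} = (if v \<in> A then B \<union> (verts T \<inter> Y) else A \<union> (verts T \<inter> X))"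
      if "v \<in> A \<union> B" for v
      using that assms(3) by (auto simp: G A_def B_def doubleton_eq_iff)
    show ?thesis
      unfolding parent_maps_def D using PiE_cong[of "A \<union> B", OF N] by simp
  qed
  finally have tau: "tau T ?G = card (bipartite_parent_maps A B (verts T \<inter> X) (verts T \<inter> Y))" .
  have st: "s \<le> m" "t \<le> n"
    using assms by (auto intro: card_mono)
  have cA: "m - s = card A" and cB: "n - t = card B"
    using assms by (auto simp: A_def B_def card_Diff_subset_Int Int_commute)
  have "A \<union> (verts T \<inter> X) = X" "B \<union> (verts T \<inter> Y) = Y" "X \<noteq> {}" "Y \<noteq> {}"
    using assms by (auto simp: A_def B_def)
  then have "real (tau T ?G) =
      (real s * real (n - t) + real t * real (m - s) + real s * real t)
        * real (m - s + s) ^ (n - t) * real (n - t + t) ^ (m - s)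
        / (real (m - s + s) * real (n - t + t))"
    unfolding tau using assms cA cB
    by (intro card_bipartite_parent_maps) (auto simp: A_def B_def)
  also have "real s * real (n - t) + real t * real (m - s) + real s * real t =
      real s * real n + real t * real m - real s * real t"
    using st by (simp add: of_nat_diff algebra_simps)
  also have "\<dots> * real (m - s + s) ^ (n - t) * real (n - t + t) ^ (m - s)
        / (real (m - s + s) * real (n - t + t)) = \<dots>
      * (real m ^ (n - t) / real m) * (real n ^ (m - s) / real n)"
    using st by simp
  \<comment> \<open>The exponent is -1 when \<open>t = n\<close>, which is why integer powers
    appear; the division needs \<open>m\<close> to be nonzero.\<close>
  also have "real m ^ (n - t) / real m = real m powi (int n - int t - 1)"
    using assms st by (simp add: power_int_diff flip: of_nat_diff)
  also have "real n ^ (m - s) / real n = real n powi (int m - int s - 1)"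
    using assms st by (simp add: power_int_diff flip: of_nat_diff)
  finally show ?thesis .
qed

end
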